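(* Let $E$ be a locally convex vector space having a countable base of neighborhoods of $0$. Then every internal subset of $\mathcal G_E$ is closed in the sharp topology.
   Context: For a locally convex space $E$ with topology generated by seminorms $(p_i)_{i\in I}$: a net $(u_\varepsilon)_\varepsilon\in E^{(0,1)}$ is moderate if for each $i\in I$ there are $M\in\mathbb N$ and $\eta\in(0,1)$ with $p_i(u_\varepsilon)\le\varepsilon^{-M}$ for all $\varepsilon\le\eta$; it is negligible if for each $i\in I$ and each $m\in\mathbb N$ there is $\eta\in(0,1)$ with $p_i(u_\varepsilon)\le\varepsilon^m$ for all $\varepsilon\le\eta$. The Colombeau space based on $E$ is the quotient $\mathcal G_E$ of the moderate nets by the negligible nets; a net in the class $u\in\mathcal G_E$ is called a representative of $u$. $\widetilde{\mathbb R}=\mathcal G_{\mathbb R}$ (with the absolute value as seminorm). Each $p_i$ induces a map $p_i:\mathcal G_E\to\widetilde{\mathbb R}$, $p_i([(u_\varepsilon)_\varepsilon])=[(p_i(u_\varepsilon))_\varepsilon]$. For $x=[(x_\varepsilon)_\varepsilon]\in\widetilde{\mathbb R}$, the valuation is $\nu(x)=\sup\{b\in\mathbb R:|x_\varepsilon|=O(\varepsilon^b)\text{ as }\varepsilon\to0\}$ and $|x|_{\mathrm e}=\exp(-\nu(x))$. The sharp topology on $\mathcal G_E$ is the topology generated by the ultra-pseudo-seminorms $u\mapsto|p_i(u)|_{\mathrm e}$, $i\in I$. A subset $A\subseteq\mathcal G_E$ is internal if there is a net $(A_\varepsilon)_{\varepsilon\in(0,1)}$ of subsets of $E$ such that $A=[(A_\varepsilon)_\varepsilon]$,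 the set of all $u\in\mathcal G_E$ for which there exist a representative $(u_\varepsilon)_\varepsilon$ of $u$ and $\eta>0$ such that $u_\varepsilon\in A_\varepsilon$ for all $\varepsilon<\eta$. *)

theory Defs
  imports "HOL-Analysis.Analysis" "HOL-Library.Landau_Symbols"
begin

section \<open>Locally convex topologies\<close>

definition seminorm :: "('a::real_vector \<Rightarrow> real) \<Rightarrow> bool" where
  "seminorm q \<longleftrightarrow>
     (\<forall>x. 0 \<le> q x) \<and> (\<forall>c x. q (c *\<^sub>R x) = \<bar>c\<bar> * q x) \<and> (\<forall>x y. q (x + y) \<le> q x + q y)"

text \<open>The set \<open>UNIV\<close> is added to the subbase so that the empty family of seminorms generates the
  indiscrete topology on the whole space.\<close>

definition seminorm_topology :: "'i set \<Rightarrow> ('i \<Rightarrow> 'a::real_vector \<Rightarrow> real) \<Rightarrow> 'a topology" where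
  "seminorm_topology I p =
     topology_generated_by (insert UNIV {{y. p i (y - x) < r} | i x r. i \<in> I \<and> 0 < r})"

definition countable_nhd_base_at :: "'a topology \<Rightarrow> 'a \<Rightarrow> bool" where
  "countable_nhd_base_at X x \<longleftrightarrow> (\<exists>\<B>. countable \<B> \<and> neighbourhood_base_at x (\<lambda>V. V \<in> \<B>) X)"

section \<open>Colombeau spaces\<close>

text \<open>Nets indexed by the interval \<open>(0,1)\<close> are functions that are \<open>undefined\<close> outside of it.\<close>

definition nets :: "(real \<Rightarrow> 'a) set" where
  "nets = {0<..<1} \<rightarrow>\<^sub>E UNIV"

definition moderate_nets :: "'i set \<Rightarrow> ('i \<Rightarrow> 'a::real_vector \<Rightarrow> real) \<Rightarrow> (real \<Rightarrow> 'a) set" where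
  "moderate_nets I p =
     {u \<in> nets. \<forall>i\<in>I. \<exists>M::nat. \<exists>\<eta>\<in>{0<..<1}. \<forall>\<epsilon>\<in>{0<..\<eta>}. p i (u \<epsilon>) \<le> \<epsilon> powr (- real M)}"

definition negligible_nets :: "'i set \<Rightarrow> ('i \<Rightarrow> 'a::real_vector \<Rightarrow> real) \<Rightarrow> (real \<Rightarrow> 'a) set" where
  "negligible_nets I p =
     {u \<in> nets. \<forall>i\<in>I. \<forall>m::nat. \<exists>\<eta>\<in>{0<..<1}. \<forall>\<epsilon>\<in>{0<..\<eta>}. p i (u \<epsilon>) \<le> \<epsilon> ^ m}"

definition net_diff :: "(real \<Rightarrow> 'a::real_vector) \<Rightarrow> (real \<Rightarrow> 'a) \<Rightarrow> (real \<Rightarrow> 'a)" where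
  "net_diff u v = (\<lambda>\<epsilon>\<in>{0<..<1}. u \<epsilon> - v \<epsilon>)"

definition colombeau_rel ::
    "'i set \<Rightarrow> ('i \<Rightarrow> 'a::real_vector \<Rightarrow> real) \<Rightarrow> ((real \<Rightarrow> 'a) \<times> (real \<Rightarrow> 'a)) set" where
  "colombeau_rel I p =
     {(u, v). u \<in> moderate_nets I p \<and> v \<in> moderate_nets I p \<and> net_diff u v \<in> negligible_nets I p}"

text \<open>An element of the Colombeau space is an equivalence class, i.e. the set of its
  representatives.\<close>

definition colombeau :: "'i set \<Rightarrow> ('i \<Rightarrow> 'a::real_vector \<Rightarrow> real) \<Rightarrow> (real \<Rightarrow> 'a) set set" where
  "colombeau I p = moderate_nets I p // colombeau_rel I p"

definition colombeau_class ::
    "'i set \<Rightarrow> ('i \<Rightarrow> 'a::real_vector \<Rightarrow> real) \<Rightarrow> (real \<Rightarrow> 'a) \<Rightarrow> (real \<Rightarrow> 'a) set" where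
  "colombeau_class I p u = colombeau_rel I p `` {u}"

text \<open>Operations on classes are given as the unique value obtained from representatives; for
  seminorms \<open>p\<close> the lemmas below show that this value does not depend on the representatives.\<close>

definition colombeau_diff ::
    "'i set \<Rightarrow> ('i \<Rightarrow> 'a::real_vector \<Rightarrow> real) \<Rightarrow> (real \<Rightarrow> 'a) set \<Rightarrow> (real \<Rightarrow> 'a) set \<Rightarrow> (real \<Rightarrow> 'a) set"
  where
  "colombeau_diff I p U V = the_elem {colombeau_class I p (net_diff u v) | u v. u \<in> U \<and> v \<in> V}"

section \<open>Generalized real numbers\<close>

abbreviation gen_real_class :: "(real \<Rightarrow> real) \<Rightarrow> (real \<Rightarrow> real) set" where
  "gen_real_class \<equiv> colombeau_class (UNIV :: unit set) (\<lambda>_ x. \<bar>x\<bar>)"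

definition induced_seminorm :: "('a::real_vector \<Rightarrow> real) \<Rightarrow> (real \<Rightarrow> 'a) set \<Rightarrow> (real \<Rightarrow> real) set" where
  "induced_seminorm q U = the_elem ((\<lambda>u. gen_real_class (\<lambda>\<epsilon>\<in>{0<..<1}. q (u \<epsilon>))) ` U)"

definition net_valuation :: "(real \<Rightarrow> real) \<Rightarrow> ereal" where
  "net_valuation x = Sup {ereal b | b. (\<lambda>\<epsilon>. \<bar>x \<epsilon>\<bar>) \<in> O[at_right 0](\<lambda>\<epsilon>. \<epsilon> powr b)}"

definition valuation :: "(real \<Rightarrow> real) set \<Rightarrow> ereal" where
  "valuation x = the_elem (net_valuation ` x)"

text \<open>The valuation is never \<open>-\<infinity>\<close> on generalized real numbers, so the value in that case is
  irrelevant.\<close>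

definition e_abs :: "(real \<Rightarrow> real) set \<Rightarrow> real" where
  "e_abs x = (case valuation x of ereal r \<Rightarrow> exp (- r) | PInfty \<Rightarrow> 0 | MInfty \<Rightarrow> undefined)"

section \<open>Independence of representatives\<close>

lemma seminorm_ge0: "seminorm q \<Longrightarrow> 0 \<le> q x"
  by (simp add: seminorm_def)

lemma seminorm_add: "seminorm q \<Longrightarrow> q (x + y) \<le> q x + q y"
  by (simp add: seminorm_def)

lemma seminorm_scale: "seminorm q \<Longrightarrow> q (c *\<^sub>R x) = \<bar>c\<bar> * q x"
  by (simp add: seminorm_def)

lemma seminorm_minus: "seminorm q \<Longrightarrow> q (- x) = q x"
  using seminorm_scale[of q "-1" x] by simp

lemma seminorm_0: "seminorm q \<Longrightarrow> q 0 = 0"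
  using seminorm_scale[of q 0 0] by simp

lemma seminorm_diff_le: "seminorm q \<Longrightarrow> \<bar>q x - q y\<bar> \<le> q (x - y)"
  using seminorm_add[of q "x - y" y] seminorm_add[of q "y - x" x] seminorm_minus[of q "x - y"]
  by simp

lemma seminorm_abs: "seminorm (\<lambda>x::real. \<bar>x\<bar>)"
  by (auto simp: seminorm_def abs_mult)

lemma net_diff_in_nets: "net_diff u v \<in> nets"
  by (auto simp: net_diff_def nets_def)

lemma negligible_add:
  assumes p: "\<And>i. i \<in> I \<Longrightarrow> seminorm (p i)"
    and u: "u \<in> negligible_nets I p" and v: "v \<in> negligible_nets I p" and w: "w \<in> nets"
    and le: "\<And>i \<epsilon>. i \<in> I \<Longrightarrow> \<epsilon> \<in> {0<..<1} \<Longrightarrow> p i (w \<epsilon>) \<le> p i (u \<epsilon>) + p i (v \<epsilon>)"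
  shows "w \<in> negligible_nets I p"
proof -
  have "\<exists>\<eta>\<in>{0<..<1}. \<forall>\<epsilon>\<in>{0<..\<eta>}. p i (w \<epsilon>) \<le> \<epsilon> ^ m" if i: "i \<in> I" for i and m :: nat
  proof -
    obtain a where a: "a \<in> {0<..<1}" "\<forall>\<epsilon>\<in>{0<..a}. p i (u \<epsilon>) \<le> \<epsilon> ^ Suc m"
      using u i unfolding negligible_nets_def by blast
    obtain b where b: "b \<in> {0<..<1}" "\<forall>\<epsilon>\<in>{0<..b}. p i (v \<epsilon>) \<le> \<epsilon> ^ Suc m"
      using v i unfolding negligible_nets_def by blast
    define c where "c = min (min a b) (1/2)"
    have "p i (w \<epsilon>) \<le> \<epsilon> ^ m" if e: "\<epsilon> \<in> {0<..c}" for \<epsilon>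
    proof -
      have "p i (w \<epsilon>) \<le> p i (u \<epsilon>) + p i (v \<epsilon>)" using le i e by (auto simp: c_def)
      also have "\<dots> \<le> \<epsilon> ^ Suc m + \<epsilon> ^ Suc m" using a b e by (intro add_mono) (auto simp: c_def)
      also have "\<dots> = (2 * \<epsilon>) * \<epsilon> ^ m" by simp
      also have "\<dots> \<le> 1 * \<epsilon> ^ m" using e by (intro mult_right_mono) (auto simp: c_def)
      finally show ?thesis by simp
    qed
    moreover have "c \<in> {0<..<1}" using a b by (auto simp: c_def)
    ultimately show ?thesis by blast
  qed
  with w show ?thesis by (auto simp: negligible_nets_def)
qed

lemma moderate_add:
  assumes p: "\<And>i. i \<in> I \<Longrightarrow> seminorm (p i)"
    and u: "u \<in> moderate_nets I p" and v: "v \<in> moderate_nets I p" and w: "w \<in> nets"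
    and le: "\<And>i \<epsilon>. i \<in> I \<Longrightarrow> \<epsilon> \<in> {0<..<1} \<Longrightarrow> p i (w \<epsilon>) \<le> p i (u \<epsilon>) + p i (v \<epsilon>)"
  shows "w \<in> moderate_nets I p"
proof -
  have "\<exists>M::nat. \<exists>\<eta>\<in>{0<..<1}. \<forall>\<epsilon>\<in>{0<..\<eta>}. p i (w \<epsilon>) \<le> \<epsilon> powr (- real M)" if i: "i \<in> I" for i
  proof -
    obtain a K where a: "a \<in> {0<..<1}" "\<forall>\<epsilon>\<in>{0<..a}. p i (u \<epsilon>) \<le> \<epsilon> powr (- real K)"
      using u i unfolding moderate_nets_def by blast
    obtain b L where b: "b \<in> {0<..<1}" "\<forall>\<epsilon>\<in>{0<..b}. p i (v \<epsilon>) \<le> \<epsilon> powr (- real L)"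
      using v i unfolding moderate_nets_def by blast
    define c where "c = min (min a b) (1/2)"
    define M where "M = Suc (max K L)"
    have "p i (w \<epsilon>) \<le> \<epsilon> powr (- real M)" if e: "\<epsilon> \<in> {0<..c}" for \<epsilon>
    proof -
      have e': "0 < \<epsilon>" "\<epsilon> \<le> 1/2" using e by (auto simp: c_def)
      have "p i (w \<epsilon>) \<le> p i (u \<epsilon>) + p i (v \<epsilon>)" using le i e by (auto simp: c_def)
      also have "\<dots> \<le> \<epsilon> powr (- real K) + \<epsilon> powr (- real L)"
        using a b e by (intro add_mono) (auto simp: c_def)
      also have "\<dots> \<le> \<epsilon> powr (1 - real M) + \<epsilon> powr (1 - real M)"
        using e' by (intro add_mono powr_mono') (auto simp: M_def)
      also have "\<dots> = (2 * \<epsilon>) * \<epsilon> powr (- real M)"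
        using e' powr_add[of \<epsilon> 1 "- real M"] by simp
      also have "\<dots> \<le> 1 * \<epsilon> powr (- real M)" using e' by (intro mult_right_mono) auto
      finally show ?thesis by simp
    qed
    moreover have "c \<in> {0<..<1}" using a b by (auto simp: c_def)
    ultimately show ?thesis by blast
  qed
  with w show ?thesis by (auto simp: moderate_nets_def)
qed

lemma equiv_colombeau_rel:
  assumes p: "\<And>i. i \<in> I \<Longrightarrow> seminorm (p i)"
  shows "equiv (moderate_nets I p) (colombeau_rel I p)"
proof (rule equivI)
  have "\<forall>\<epsilon>\<in>{0<..1/2}. p i (net_diff u u \<epsilon>) \<le> \<epsilon> ^ m" if "i \<in> I" for u i and m :: nat
    using seminorm_0[OF p[OF that]] by (simp add: net_diff_def)
  moreover have "1/2 \<in> {0<..<1::real}" by simp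
  ultimately have "net_diff u u \<in> negligible_nets I p" for u
    unfolding negligible_nets_def using net_diff_in_nets by blast
  then show "refl_on (moderate_nets I p) (colombeau_rel I p)"
    by (auto simp: refl_on_def colombeau_rel_def)
  show "colombeau_rel I p \<subseteq> moderate_nets I p \<times> moderate_nets I p"
    by (auto simp: colombeau_rel_def)
  show "sym (colombeau_rel I p)"
  proof (rule symI)
    fix u v assume uv: "(u, v) \<in> colombeau_rel I p"
    then have n: "net_diff u v \<in> negligible_nets I p" by (simp add: colombeau_rel_def)
    have "net_diff v u \<in> negligible_nets I p"
    proof (rule negligible_add[OF p n n net_diff_in_nets])
      fix i \<epsilon> assume i: "i \<in> I" and e: "\<epsilon> \<in> {0<..<1::real}"
      have "p i (v \<epsilon> - u \<epsilon>) = p i (u \<epsilon> - v \<epsilon>)" using seminorm_minus[OF p[OF i], of "u \<epsilon> - v \<epsilon>"] by simp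
      then show "p i (net_diff v u \<epsilon>) \<le> p i (net_diff u v \<epsilon>) + p i (net_diff u v \<epsilon>)"
        using e seminorm_ge0[OF p[OF i]] by (simp add: net_diff_def)
    qed auto
    with uv show "(v, u) \<in> colombeau_rel I p" by (simp add: colombeau_rel_def)
  qed
  show "trans (colombeau_rel I p)"
  proof (rule transI)
    fix u v w assume uv: "(u, v) \<in> colombeau_rel I p" and vw: "(v, w) \<in> colombeau_rel I p"
    have n: "net_diff u v \<in> negligible_nets I p" "net_diff v w \<in> negligible_nets I p"
      using uv vw by (simp_all add: colombeau_rel_def)
    have "net_diff u w \<in> negligible_nets I p"
    proof (rule negligible_add[OF p n net_diff_in_nets])
      fix i \<epsilon> assume i: "i \<in> I" and e: "\<epsilon> \<in> {0<..<1::real}"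
      show "p i (net_diff u w \<epsilon>) \<le> p i (net_diff u v \<epsilon>) + p i (net_diff v w \<epsilon>)"
        using e seminorm_add[OF p[OF i], of "u \<epsilon> - v \<epsilon>" "v \<epsilon> - w \<epsilon>"] by (simp add: net_diff_def)
    qed auto
    with uv vw show "(u, w) \<in> colombeau_rel I p" by (simp add: colombeau_rel_def)
  qed
qed

lemma colombeau_diff_class:
  assumes p: "\<And>i. i \<in> I \<Longrightarrow> seminorm (p i)"
    and u: "u \<in> moderate_nets I p" and v: "v \<in> moderate_nets I p"
  shows "net_diff u v \<in> moderate_nets I p"
    and "colombeau_diff I p (colombeau_class I p u) (colombeau_class I p v)
           = colombeau_class I p (net_diff u v)"
proof -
  have mod: "net_diff a b \<in> moderate_nets I p"
    if a: "a \<in> moderate_nets I p" and b: "b \<in> moderate_nets I p" for a b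
  proof (rule moderate_add[OF p a b net_diff_in_nets])
    fix i \<epsilon> assume i: "i \<in> I" and e: "\<epsilon> \<in> {0<..<1::real}"
    show "p i (net_diff a b \<epsilon>) \<le> p i (a \<epsilon>) + p i (b \<epsilon>)"
      using e seminorm_add[OF p[OF i], of "a \<epsilon>" "- b \<epsilon>"] seminorm_minus[OF p[OF i], of "b \<epsilon>"]
      by (simp add: net_diff_def)
  qed auto
  then show m: "net_diff u v \<in> moderate_nets I p" using u v by blast
  have eq: "equiv (moderate_nets I p) (colombeau_rel I p)" using p by (rule equiv_colombeau_rel)
  have self: "u \<in> colombeau_class I p u" "v \<in> colombeau_class I p v"
    using equiv_class_self[OF eq u] equiv_class_self[OF eq v] by (simp_all add: colombeau_class_def)
  have "colombeau_class I p (net_diff a b) = colombeau_class I p (net_diff u v)"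
    if "a \<in> colombeau_class I p u" "b \<in> colombeau_class I p v" for a b
  proof -
    have a: "a \<in> moderate_nets I p" "net_diff u a \<in> negligible_nets I p"
      and b: "b \<in> moderate_nets I p" "net_diff v b \<in> negligible_nets I p"
      using that by (auto simp: colombeau_class_def colombeau_rel_def)
    have "net_diff (net_diff u v) (net_diff a b) \<in> negligible_nets I p"
    proof (rule negligible_add[OF p a(2) b(2) net_diff_in_nets])
      fix i \<epsilon> assume i: "i \<in> I" and e: "\<epsilon> \<in> {0<..<1::real}"
      show "p i (net_diff (net_diff u v) (net_diff a b) \<epsilon>) \<le> p i (net_diff u a \<epsilon>) + p i (net_diff v b \<epsilon>)"
        using e seminorm_add[OF p[OF i], of "u \<epsilon> - a \<epsilon>" "- (v \<epsilon> - b \<epsilon>)"]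
          seminorm_minus[OF p[OF i], of "v \<epsilon> - b \<epsilon>"]
        by (simp add: net_diff_def algebra_simps)
    qed auto
    then have "(net_diff u v, net_diff a b) \<in> colombeau_rel I p"
      using m mod a b by (simp add: colombeau_rel_def)
    from equiv_class_eq[OF eq this] show ?thesis by (simp add: colombeau_class_def)
  qed
  then have "{colombeau_class I p (net_diff a b) | a b.
                a \<in> colombeau_class I p u \<and> b \<in> colombeau_class I p v}
             = {colombeau_class I p (net_diff u v)}" using self by blast
  then show "colombeau_diff I p (colombeau_class I p u) (colombeau_class I p v)
           = colombeau_class I p (net_diff u v)" by (simp add: colombeau_diff_def)
qed

lemma induced_seminorm_class:
  assumes p: "\<And>i. i \<in> I \<Longrightarrow> seminorm (p i)" and i: "i \<in> I" and u: "u \<in> moderate_nets I p"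
  shows "(\<lambda>\<epsilon>\<in>{0<..<1}. p i (u \<epsilon>)) \<in> moderate_nets (UNIV :: unit set) (\<lambda>_ x. \<bar>x\<bar>)"
    and "induced_seminorm (p i) (colombeau_class I p u) = gen_real_class (\<lambda>\<epsilon>\<in>{0<..<1}. p i (u \<epsilon>))"
proof -
  let ?q = "\<lambda>u. \<lambda>\<epsilon>\<in>{0<..<1::real}. p i (u \<epsilon>)"
  note pi = p[OF i]
  have net: "?q a \<in> nets" for a by (auto simp: nets_def)
  have mod: "?q a \<in> moderate_nets (UNIV :: unit set) (\<lambda>_ x. \<bar>x\<bar>)" if a: "a \<in> moderate_nets I p" for a
  proof -
    obtain \<eta> M where *: "\<eta> \<in> {0<..<1}" "\<forall>\<epsilon>\<in>{0<..\<eta>}. p i (a \<epsilon>) \<le> \<epsilon> powr (- real M)"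
      using a i unfolding moderate_nets_def by blast
    then have "\<forall>\<epsilon>\<in>{0<..\<eta>}. \<bar>?q a \<epsilon>\<bar> \<le> \<epsilon> powr (- real M)"
      using seminorm_ge0[OF pi] by auto
    with *(1) net show ?thesis unfolding moderate_nets_def by blast
  qed
  then show "?q u \<in> moderate_nets (UNIV :: unit set) (\<lambda>_ x. \<bar>x\<bar>)" using u .
  note eq = equiv_colombeau_rel[of "UNIV :: unit set" "\<lambda>_ x. \<bar>x::real\<bar>", OF seminorm_abs]
  have "gen_real_class (?q a) = gen_real_class (?q u)" if "a \<in> colombeau_class I p u" for a
  proof -
    have a: "a \<in> moderate_nets I p" "net_diff u a \<in> negligible_nets I p"
      using that by (auto simp: colombeau_class_def colombeau_rel_def)
    have "\<exists>\<eta>\<in>{0<..<1}. \<forall>\<epsilon>\<in>{0<..\<eta>}. \<bar>net_diff (?q u) (?q a) \<epsilon>\<bar> \<le> \<epsilon> ^ m" for m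
    proof -
      obtain \<eta> where *: "\<eta> \<in> {0<..<1}" "\<forall>\<epsilon>\<in>{0<..\<eta>}. p i (net_diff u a \<epsilon>) \<le> \<epsilon> ^ m"
        using a(2) i unfolding negligible_nets_def by blast
      have "\<bar>net_diff (?q u) (?q a) \<epsilon>\<bar> \<le> \<epsilon> ^ m" if e: "\<epsilon> \<in> {0<..\<eta>}" for \<epsilon>
        using *(1) *(2)[rule_format, OF e] e seminorm_diff_le[OF pi, of "u \<epsilon>" "a \<epsilon>"]
        by (simp add: net_diff_def)
      with *(1) show ?thesis by blast
    qed
    then have "net_diff (?q u) (?q a) \<in> negligible_nets (UNIV :: unit set) (\<lambda>_ x. \<bar>x\<bar>)"
      by (auto simp: negligible_nets_def net_diff_in_nets)
    then have "(?q u, ?q a) \<in> colombeau_rel (UNIV :: unit set) (\<lambda>_ x. \<bar>x\<bar>)"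
      using mod a(1) u by (simp add: colombeau_rel_def)
    from equiv_class_eq[OF eq this] show ?thesis by (simp add: colombeau_class_def)
  qed
  moreover have "u \<in> colombeau_class I p u"
    using equiv_class_self[OF equiv_colombeau_rel[OF p] u] by (simp add: colombeau_class_def)
  ultimately have "(\<lambda>u. gen_real_class (?q u)) ` colombeau_class I p u = {gen_real_class (?q u)}" by blast
  then show "induced_seminorm (p i) (colombeau_class I p u) = gen_real_class (?q u)"
    by (simp add: induced_seminorm_def)
qed

lemma negligible_bigo:
  assumes "x \<in> negligible_nets (UNIV :: unit set) (\<lambda>_ x. \<bar>x\<bar>)"
  shows "x \<in> O[at_right 0](\<lambda>\<epsilon>. \<epsilon> powr b)"
proof -
  obtain m :: nat where m: "b \<le> real m" using real_arch_simple by blast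
  obtain \<eta> where e: "\<eta> \<in> {0<..<1}" "\<forall>\<epsilon>\<in>{0<..\<eta>}. \<bar>x \<epsilon>\<bar> \<le> \<epsilon> ^ m"
    using assms unfolding negligible_nets_def by blast
  have "\<forall>\<^sub>F \<epsilon> in at_right 0. norm (x \<epsilon>) \<le> 1 * norm (\<epsilon> powr b)"
  proof (rule eventually_at_right_less[THEN eventually_rev_mp, of 0], 
      rule eventually_mono[OF eventually_at_rightI[of 0 \<eta> "\<lambda>\<epsilon>. 0 < \<epsilon> \<and> \<epsilon> < \<eta>"]])
    fix \<epsilon> assume h: "0 < \<epsilon> \<and> \<epsilon> < \<eta>"
    then have "\<bar>x \<epsilon>\<bar> \<le> \<epsilon> powr real m" using e by (simp add: powr_realpow)
    also have "\<dots> \<le> \<epsilon> powr b" using h e m by (intro powr_mono') auto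
    finally show "0 < \<epsilon> \<longrightarrow> norm (x \<epsilon>) \<le> 1 * norm (\<epsilon> powr b)" by simp
  qed (use e in auto)
  then show ?thesis by (rule bigoI)
qed

lemma valuation_class:
  assumes x: "x \<in> moderate_nets (UNIV :: unit set) (\<lambda>_ x. \<bar>x\<bar>)"
  shows "valuation (gen_real_class x) = net_valuation x" and "valuation (gen_real_class x) \<noteq> -\<infinity>"
proof -
  note eq = equiv_colombeau_rel[of "UNIV :: unit set" "\<lambda>_ x. \<bar>x::real\<bar>", OF seminorm_abs]
  have imp: "b \<in> O[at_right 0](\<lambda>\<epsilon>. \<epsilon> powr s)"
    if "net_diff a b \<in> negligible_nets (UNIV :: unit set) (\<lambda>_ x. \<bar>x\<bar>)"
      and a: "a \<in> O[at_right 0](\<lambda>\<epsilon>. \<epsilon> powr s)" for a b s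
  proof -
    have "(\<lambda>\<epsilon>. a \<epsilon> - net_diff a b \<epsilon>) \<in> O[at_right 0](\<lambda>\<epsilon>. \<epsilon> powr s)"
      by (rule sum_in_bigo(2)[OF a negligible_bigo[OF that(1)]])
    moreover have "\<forall>\<^sub>F \<epsilon> in at_right 0. a \<epsilon> - net_diff a b \<epsilon> = b \<epsilon>"
      by (rule eventually_at_rightI[of 0 1]) (auto simp: net_diff_def)
    ultimately show ?thesis by (simp cong: landau_o.big.in_cong)
  qed
  have "net_valuation a = net_valuation x" if "a \<in> gen_real_class x" for a
  proof -
    have "(x, a) \<in> colombeau_rel (UNIV :: unit set) (\<lambda>_ x. \<bar>x\<bar>)"
      using that by (simp add: colombeau_class_def)
    moreover from this have "(a, x) \<in> colombeau_rel (UNIV :: unit set) (\<lambda>_ x. \<bar>x\<bar>)"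
      using eq by (meson equivE symD)
    ultimately have "a \<in> O[at_right 0](\<lambda>\<epsilon>. \<epsilon> powr s) \<longleftrightarrow> x \<in> O[at_right 0](\<lambda>\<epsilon>. \<epsilon> powr s)" for s
      using imp by (auto simp: colombeau_rel_def)
    then show ?thesis by (simp add: net_valuation_def)
  qed
  moreover have "x \<in> gen_real_class x"
    using equiv_class_self[OF eq x] by (simp add: colombeau_class_def)
  ultimately have "net_valuation ` gen_real_class x = {net_valuation x}" by blast
  then show *: "valuation (gen_real_class x) = net_valuation x" by (simp add: valuation_def)
  obtain \<eta> M where e: "\<eta> \<in> {0<..<1}" "\<forall>\<epsilon>\<in>{0<..\<eta>}. \<bar>x \<epsilon>\<bar> \<le> \<epsilon> powr (- real M)"
    using x unfolding moderate_nets_def by blast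
  have "\<forall>\<^sub>F \<epsilon> in at_right 0. norm \<bar>x \<epsilon>\<bar> \<le> 1 * norm (\<epsilon> powr (- real M))"
    by (rule eventually_at_rightI[of 0 \<eta>]) (use e in auto)
  from bigoI[OF this] have "ereal (- real M) \<le> net_valuation x"
    unfolding net_valuation_def by (intro Sup_upper) blast
  then show "valuation (gen_real_class x) \<noteq> -\<infinity>" unfolding * by auto
qed

section \<open>Sharp topology and internal sets\<close>

definition sharp_topology ::
    "'i set \<Rightarrow> ('i \<Rightarrow> 'a::real_vector \<Rightarrow> real) \<Rightarrow> (real \<Rightarrow> 'a) set topology" where
  "sharp_topology I p =
     topology_generated_by (insert (colombeau I p)
       {{v \<in> colombeau I p. e_abs (induced_seminorm (p i) (colombeau_diff I p v u)) < r} | i u r.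
          i \<in> I \<and> u \<in> colombeau I p \<and> 0 < r})"

definition internal_set ::
    "'i set \<Rightarrow> ('i \<Rightarrow> 'a::real_vector \<Rightarrow> real) \<Rightarrow> (real \<Rightarrow> 'a set) \<Rightarrow> (real \<Rightarrow> 'a) set set" where
  "internal_set I p A =
     {U \<in> colombeau I p. \<exists>u\<in>U. \<exists>\<eta>>0. \<forall>\<epsilon>\<in>{0<..<1}. \<epsilon> < \<eta> \<longrightarrow> u \<epsilon> \<in> A \<epsilon>}"

definition internal ::
    "'i set \<Rightarrow> ('i \<Rightarrow> 'a::real_vector \<Rightarrow> real) \<Rightarrow> (real \<Rightarrow> 'a) set set \<Rightarrow> bool" where
  "internal I p \<A> \<longleftrightarrow> (\<exists>A. \<A> = internal_set I p A)"

end

theory Submission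
  imports Defs
begin

text \<open>
  A point \<open>U\<close> of the sharp closure of an internal set is approximated by members \<open>W n\<close> at precision
  \<open>exp (- n)\<close>. Such a member has a representative \<open>w n\<close> with \<open>w n \<epsilon> \<in> A \<epsilon>\<close> for small \<open>\<epsilon>\<close>, and if
  \<open>u\<close> represents \<open>U\<close>, then the precision means \<open>p i (w n \<epsilon> - u \<epsilon>) \<le> \<epsilon> ^ n\<close> for small \<open>\<epsilon>\<close>
  (\<open>sharp_dist_less_imp_eventually_le\<close>). How small \<open>\<epsilon>\<close> must be depends on \<open>n\<close>, but one can let \<open>n\<close>
  depend on \<open>\<epsilon>\<close> and grow so slowly, as \<open>\<epsilon> \<rightarrow> 0\<close>, that both properties hold at the index \<open>N \<epsilon>\<close>
  (\<open>diagonal_choice_at_right_0\<close>). The diagonal net \<open>v \<epsilon> = w (N \<epsilon>) \<epsilon>\<close> then lies in \<open>A \<epsilon>\<close> for small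
  \<open>\<epsilon>\<close> and differs from \<open>u\<close> by a negligible net, so it is a representative of \<open>U\<close> witnessing that \<open>U\<close>
  belongs to the internal set (\<open>internal_set_sharp_limit\<close>).

  Countability enters in choosing the approximants. A sharp neighborhood controls only finitely many
  seminorms at once, so a single sequence \<open>W\<close> can serve all of them only if they are governed by a
  sequence of finite sets \<open>G n\<close>. A countable base of neighborhoods of \<open>0\<close> provides it: each
  \<open>p i\<close> is bounded by a multiple of a finite sum of seminorms that all belong to \<open>G n\<close> for large \<open>n\<close>
  (\<open>countable_exhaustion_of_seminorms\<close>).
\<close>

section \<open>Diagonal sequences\<close>

lemma eventually_at_right_0_iff:
  "eventually P (at_right (0::real)) \<longleftrightarrow> (\<exists>\<eta>\<in>{0<..<1}. \<forall>\<epsilon>\<in>{0<..\<eta>}. P \<epsilon>)"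
proof
  assume "eventually P (at_right 0)"
  then obtain b where b: "0 < b" "\<And>\<epsilon>. 0 < \<epsilon> \<Longrightarrow> \<epsilon> < b \<Longrightarrow> P \<epsilon>"
    by (auto simp: eventually_at_right_field)
  show "\<exists>\<eta>\<in>{0<..<1}. \<forall>\<epsilon>\<in>{0<..\<eta>}. P \<epsilon>"
    using b by (intro bexI[of _ "min (b / 2) (1 / 2)"]) auto
next
  assume "\<exists>\<eta>\<in>{0<..<1}. \<forall>\<epsilon>\<in>{0<..\<eta>}. P \<epsilon>"
  then show "eventually P (at_right 0)"
    by (auto simp: eventually_at_right_field intro: less_imp_le)
qed

lemma eventually_at_right_0_in_unit_interval: "\<forall>\<^sub>F \<epsilon> in at_right 0. \<epsilon> \<in> {0<..<1::real}"
  by (rule eventually_at_rightI[of 0 1]) auto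

text \<open>The index \<open>N \<epsilon>\<close> is the largest \<open>n \<le> 1 / \<epsilon>\<close> at which \<open>Q n \<epsilon>\<close> holds. The bound
  \<open>1 / \<epsilon>\<close> makes the maximum exist and tends to infinity, so that every fixed \<open>n\<close> eventually competes
  for the maximum.\<close>

lemma diagonal_choice_at_right_0:
  fixes Q :: "nat \<Rightarrow> real \<Rightarrow> bool"
  assumes Q: "\<And>n. eventually (Q n) (at_right 0)"
  obtains N where "filterlim N sequentially (at_right 0)"
    and "eventually (\<lambda>\<epsilon>. Q (N \<epsilon>) \<epsilon>) (at_right 0)"
proof -
  define S where "S \<epsilon> = {n. real n \<le> 1 / \<epsilon> \<and> Q n \<epsilon>}" for \<epsilon>
  define N where "N \<epsilon> = Max (S \<epsilon>)" for \<epsilon>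
  have fin: "finite (S \<epsilon>)" for \<epsilon>
    by (rule finite_subset[of _ "{..nat \<lfloor>1 / \<epsilon>\<rfloor>}"]) (auto simp: S_def le_nat_floor)
  have inS: "\<forall>\<^sub>F \<epsilon> in at_right 0. n \<in> S \<epsilon>" for n
  proof -
    have "\<forall>\<^sub>F \<epsilon> in at_right 0. real n \<le> 1 / \<epsilon>"
      using filterlim_inverse_at_top_right
      by (auto simp: filterlim_at_top inverse_eq_divide)
    then show ?thesis using Q[of n] by eventually_elim (simp add: S_def)
  qed
  show ?thesis
  proof
    show "filterlim N sequentially (at_right 0)"
      unfolding filterlim_at_top
    proof
      fix n show "\<forall>\<^sub>F \<epsilon> in at_right 0. n \<le> N \<epsilon>"
        using inS[of n] by eventually_elim (simp add: N_def fin)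
    qed
    show "\<forall>\<^sub>F \<epsilon> in at_right 0. Q (N \<epsilon>) \<epsilon>"
      using inS[of 0]
    proof eventually_elim
      case (elim \<epsilon>)
      then have "N \<epsilon> \<in> S \<epsilon>" unfolding N_def using fin by (intro Max_in) auto
      then show ?case by (simp add: S_def)
    qed
  qed
qed

section \<open>Countability of the family of seminorms\<close>

text \<open>The subbase consists of balls around arbitrary points, but by the triangle inequality a ball
  around \<open>z\<close> that contains \<open>x\<close> includes a ball around \<open>x\<close>; finite intersections and unions then
  follow the generation of the topology.\<close>

lemma seminorm_topology_basic_nhd:
  assumes p: "\<And>i. i \<in> I \<Longrightarrow> seminorm (p i)"
    and W: "openin (seminorm_topology I p) W" and x: "x \<in> W"
  shows "\<exists>F r. finite F \<and> F \<subseteq> I \<and> 0 < r \<and> {y. \<forall>i\<in>F. p i (y - x) < r} \<subseteq> W"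
proof -
  let ?S = "insert UNIV {{y. p i (y - x) < r} | i x r. i \<in> I \<and> 0 < r}"
  have "generate_topology_on ?S W"
    using W by (simp add: seminorm_topology_def openin_topology_generated_by_iff)
  then show ?thesis using x
  proof induction
    case Empty
    then show ?case by simp
  next
    case (Int a b)
    obtain F r where F: "finite F" "F \<subseteq> I" "0 < r" "{y. \<forall>i\<in>F. p i (y - x) < r} \<subseteq> a"
      using Int by auto
    obtain G s where G: "finite G" "G \<subseteq> I" "0 < s" "{y. \<forall>i\<in>G. p i (y - x) < s} \<subseteq> b"
      using Int by auto
    have "{y. \<forall>i\<in>F \<union> G. p i (y - x) < min r s} \<subseteq> a \<inter> b"
      using F(4) G(4) by auto
    then show ?case using F G by (intro exI[of _ "F \<union> G"] exI[of _ "min r s"]) auto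
  next
    case (UN K)
    then obtain k where k: "k \<in> K" "x \<in> k" by blast
    have "k \<subseteq> \<Union>K" using k(1) by (rule Union_upper)
    with UN.IH[OF k] show ?case by (meson order_trans)
  next
    case (Basis s)
    show ?case
    proof (cases "s = UNIV")
      case True
      then show ?thesis by (intro exI[of _ "{}"] exI[of _ 1]) auto
    next
      case False
      with Basis obtain i z r where s: "i \<in> I" "s = {y. p i (y - z) < r}"
        by auto
      have "p i (y - z) < r" if "p i (y - x) < r - p i (x - z)" for y
        using seminorm_add[OF p[OF s(1)], of "y - x" "x - z"] that by simp
      moreover have "0 < r - p i (x - z)" using Basis s by simp
      ultimately show ?thesis using s by (intro exI[of _ "{i}"] exI[of _ "r - p i (x - z)"]) auto
    qed
  qed
qed

text \<open>The usual scaling argument: a seminorm is bounded by others as soon as their small balls lie in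
  its unit ball. Since the sum may vanish at \<open>y\<close>, one scales \<open>y\<close> by \<open>r / t\<close> for every \<open>t\<close> strictly
  above the sum and lets \<open>t\<close> decrease to it.\<close>

lemma seminorm_le_sum_of_ball_subset:
  assumes q: "seminorm q" and p: "\<And>j. j \<in> F \<Longrightarrow> seminorm (p j)" and F: "finite F" and r: "0 < r"
    and sub: "{y. \<forall>j\<in>F. p j y < r} \<subseteq> {y. q y < 1}"
  shows "q y \<le> 1 / r * (\<Sum>j\<in>F. p j y)"
proof -
  let ?s = "\<Sum>j\<in>F. p j y"
  have s0: "0 \<le> ?s" using p by (intro sum_nonneg seminorm_ge0) auto
  have "r * q y \<le> t" if t: "?s < t" for t
  proof -
    have t0: "0 < t" using s0 t by simp
    have "p j ((r / t) *\<^sub>R y) < r" if j: "j \<in> F" for j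
    proof -
      have "p j y \<le> ?s"
        using F j p by (intro member_le_sum) (auto intro: seminorm_ge0)
      then have "p j y < t" using t by simp
      then show ?thesis using r t0 by (simp add: seminorm_scale[OF p[OF j]] field_simps)
    qed
    then have "q ((r / t) *\<^sub>R y) < 1" using sub by auto
    then show ?thesis using r t0 by (simp add: seminorm_scale[OF q] field_simps)
  qed
  then have "r * q y \<le> ?s" by (rule dense_ge)
  then show ?thesis using r by (simp add: field_simps)
qed

text \<open>Each set of the countable base that is a neighborhood of \<open>0\<close> includes a ball of finitely many
  seminorms. Collecting one such finite set per member of the base gives a countable subfamily \<open>J\<close>,
  and \<open>G n\<close> consists of the members of \<open>J\<close> with number at most \<open>n\<close> in an enumeration of \<open>J\<close>.
  Every \<open>p i\<close> is bounded in terms of \<open>J\<close>, because its unit ball includes a set of the base.\<close>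

lemma countable_exhaustion_of_seminorms:
  assumes p: "\<And>i. i \<in> I \<Longrightarrow> seminorm (p i)"
    and base: "countable_nhd_base_at (seminorm_topology I p) 0"
  obtains G :: "nat \<Rightarrow> 'i set"
  where "\<And>n. finite (G n)" and "\<And>n. G n \<subseteq> I"
    and "\<And>i. i \<in> I \<Longrightarrow> \<exists>F C. finite F \<and> (\<forall>\<^sub>F n in sequentially. F \<subseteq> G n) \<and>
           (\<forall>y. p i y \<le> C * (\<Sum>j\<in>F. p j y))"
proof -
  let ?X = "seminorm_topology I p"
  obtain \<B> where cB: "countable \<B>" and nB: "neighbourhood_base_at 0 (\<lambda>V. V \<in> \<B>) ?X"
    using base by (auto simp: countable_nhd_base_at_def)
  define fits where "fits V F r \<longleftrightarrow> finite F \<and> F \<subseteq> I \<and> 0 < r \<and> {y. \<forall>i\<in>F. p i y < r} \<subseteq> V" for V F r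
  \<comment> \<open>The choice of \<open>\<Phi> V\<close> does not depend on a seminorm \<open>i\<close>; this is what keeps \<open>J\<close> countable.\<close>
  define \<Phi> where "\<Phi> V = (SOME F. \<exists>r. fits V F r)" for V
  have \<Phi>: "\<exists>r. fits V (\<Phi> V) r" if "\<exists>F r. fits V F r" for V
    unfolding \<Phi>_def using that by (rule someI_ex)
  define J where "J = (\<Union>V\<in>{V\<in>\<B>. \<exists>r. fits V (\<Phi> V) r}. \<Phi> V)"
  have cJ: "countable J" unfolding J_def
    using cB by (intro countable_UN) (auto simp: fits_def intro: countable_finite)
  have JI: "J \<subseteq> I" by (auto simp: J_def fits_def)
  define G where "G n = {j \<in> J. to_nat_on J j \<le> n}" for n
  have fin: "finite (G n)" for n
  proof (rule inj_on_finite)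
    show "inj_on (to_nat_on J) (G n)"
      using inj_on_to_nat_on[OF cJ] by (rule inj_on_subset) (auto simp: G_def)
    show "to_nat_on J ` G n \<subseteq> {..n}" by (auto simp: G_def)
  qed simp
  show thesis
  proof (rule that[of G])
    fix n show "finite (G n)" by (rule fin)
    show "G n \<subseteq> I" using JI by (auto simp: G_def)
  next
    fix i assume i: "i \<in> I"
    have "openin ?X {y. p i (y - 0) < 1}"
      unfolding seminorm_topology_def
      by (rule topology_generated_by_Basis) (use i zero_less_one in blast)
    moreover have "0 \<in> {y. p i (y - 0) < 1}"
      using seminorm_0[OF p[OF i]] by simp
    ultimately obtain U V where UV: "openin ?X U" "V \<in> \<B>" "0 \<in> U" "U \<subseteq> V" "V \<subseteq> {y. p i (y - 0) < 1}"
      using nB unfolding neighbourhood_base_at_def by meson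
    have "\<exists>F r. fits V F r"
      using seminorm_topology_basic_nhd[of I p, OF p UV(1,3)] UV(4) by (fastforce simp: fits_def)
    from \<Phi>[OF this] obtain r where r: "fits V (\<Phi> V) r" by blast
    then have F: "finite (\<Phi> V)" "\<Phi> V \<subseteq> I" "0 < r" "{y. \<forall>j\<in>\<Phi> V. p j y < r} \<subseteq> V"
      by (auto simp: fits_def)
    have "\<Phi> V \<subseteq> J" using r UV(2) by (auto simp: J_def)
    then have "\<forall>\<^sub>F n in sequentially. \<forall>j\<in>\<Phi> V. j \<in> G n"
      using F(1) by (intro eventually_ball_finite) (auto simp: G_def eventually_sequentially)
    then have "\<forall>\<^sub>F n in sequentially. \<Phi> V \<subseteq> G n" by eventually_elim auto
    moreover have "\<forall>y. p i y \<le> 1 / r * (\<Sum>j\<in>\<Phi> V. p j y)"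
      using F UV(5) p i by (intro allI seminorm_le_sum_of_ball_subset) auto
    ultimately show "\<exists>F C. finite F \<and> (\<forall>\<^sub>F n in sequentially. F \<subseteq> G n) \<and>
           (\<forall>y. p i y \<le> C * (\<Sum>j\<in>F. p j y))"
      using F(1) by blast
  qed
qed

section \<open>Representatives and sharp balls\<close>

lemma colombeau_representative:
  assumes p: "\<And>i. i \<in> I \<Longrightarrow> seminorm (p i)"
    and U: "U \<in> colombeau I p" and u: "u \<in> U"
  shows "u \<in> moderate_nets I p" and "U = colombeau_class I p u"
proof -
  note eq = equiv_colombeau_rel[of I p, OF p]
  obtain w where w: "w \<in> moderate_nets I p" "U = colombeau_rel I p `` {w}"
    using U by (auto simp: colombeau_def elim: quotientE)
  have r: "(w, u) \<in> colombeau_rel I p" using w u by simp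
  then show "u \<in> moderate_nets I p" by (simp add: colombeau_rel_def)
  show "U = colombeau_class I p u"
    using equiv_class_eq[OF eq r] w by (simp add: colombeau_class_def)
qed

lemma colombeau_nonempty:
  assumes p: "\<And>i. i \<in> I \<Longrightarrow> seminorm (p i)" and U: "U \<in> colombeau I p"
  obtains u where "u \<in> U"
  using in_quotient_imp_non_empty[OF equiv_colombeau_rel[of I p, OF p]] U
  unfolding colombeau_def by blast

definition sharp_dist ::
    "'i set \<Rightarrow> ('i \<Rightarrow> 'a::real_vector \<Rightarrow> real) \<Rightarrow> 'i \<Rightarrow> (real \<Rightarrow> 'a) set \<Rightarrow> (real \<Rightarrow> 'a) set \<Rightarrow> real" where
  "sharp_dist I p i U V = e_abs (induced_seminorm (p i) (colombeau_diff I p U V))"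

lemma valuation_colombeau_diff:
  assumes p: "\<And>i. i \<in> I \<Longrightarrow> seminorm (p i)" and i: "i \<in> I"
    and U: "U \<in> colombeau I p" "u \<in> U" and V: "V \<in> colombeau I p" "v \<in> V"
  shows "valuation (induced_seminorm (p i) (colombeau_diff I p U V))
           = net_valuation (\<lambda>\<epsilon>\<in>{0<..<1}. p i (net_diff u v \<epsilon>))"
    and "valuation (induced_seminorm (p i) (colombeau_diff I p U V)) \<noteq> -\<infinity>"
proof -
  note u = colombeau_representative[of I p, OF p U]
  note v = colombeau_representative[of I p, OF p V]
  note d = colombeau_diff_class[of I p, OF p u(1) v(1)]
  note s = induced_seminorm_class[of I p, OF p i d(1)]
  show "valuation (induced_seminorm (p i) (colombeau_diff I p U V))
           = net_valuation (\<lambda>\<epsilon>\<in>{0<..<1}. p i (net_diff u v \<epsilon>))"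
    using valuation_class(1)[OF s(1)] d(2) s(2) u(2) v(2) by simp
  show "valuation (induced_seminorm (p i) (colombeau_diff I p U V)) \<noteq> -\<infinity>"
    using valuation_class(2)[OF s(1)] d(2) s(2) u(2) v(2) by simp
qed

text \<open>The difference has valuation \<open>\<infinity>\<close>. This is what puts a point into the balls around it.\<close>

lemma sharp_dist_self:
  assumes p: "\<And>i. i \<in> I \<Longrightarrow> seminorm (p i)" and i: "i \<in> I" and U: "U \<in> colombeau I p"
  shows "sharp_dist I p i U U = 0"
proof -
  obtain u where u: "u \<in> U" using colombeau_nonempty[of I p, OF p U] by blast
  let ?x = "\<lambda>\<epsilon>\<in>{0<..<1}. p i (net_diff u u \<epsilon>)"
  have x: "?x \<epsilon> = 0" if "\<epsilon> \<in> {0<..<1}" for \<epsilon>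
    using that seminorm_0[OF p[OF i]] by (simp add: net_diff_def)
  have "\<forall>\<^sub>F \<epsilon> in at_right 0. norm \<bar>?x \<epsilon>\<bar> \<le> 1 * norm (\<epsilon> powr b)" for b
    by (rule eventually_at_rightI[of 0 1]) (use x in auto)
  then have O: "(\<lambda>\<epsilon>. \<bar>?x \<epsilon>\<bar>) \<in> O[at_right 0](\<lambda>\<epsilon>. \<epsilon> powr b)" for b by (rule bigoI)
  have "net_valuation ?x = \<infinity>"
    unfolding net_valuation_def
  proof (rule ereal_top)
    fix b show "ereal b \<le> Sup {ereal b |b. (\<lambda>\<epsilon>. \<bar>?x \<epsilon>\<bar>) \<in> O[at_right 0](\<lambda>\<epsilon>. \<epsilon> powr b)}"
      using O by (intro Sup_upper) blast
  qed
  then show ?thesis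
    using valuation_colombeau_diff(1)[of I p, OF p i U u U u] by (simp add: sharp_dist_def e_abs_def)
qed

text \<open>The strict inequality leaves room for an exponent \<open>b > n\<close> with
  \<open>p i (u \<epsilon> - v \<epsilon>) = O(\<epsilon> powr b)\<close>. The gap \<open>b - n\<close> absorbs the constant hidden in the \<open>O\<close>,
  which yields the bound \<open>\<epsilon> ^ n\<close> with constant \<open>1\<close>.\<close>

lemma sharp_dist_less_imp_eventually_le:
  assumes p: "\<And>i. i \<in> I \<Longrightarrow> seminorm (p i)" and i: "i \<in> I"
    and U: "U \<in> colombeau I p" "u \<in> U" and V: "V \<in> colombeau I p" "v \<in> V"
    and less: "sharp_dist I p i U V < exp (- real n)"
  shows "\<forall>\<^sub>F \<epsilon> in at_right 0. p i (u \<epsilon> - v \<epsilon>) \<le> \<epsilon> ^ n"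
proof -
  let ?x = "\<lambda>\<epsilon>\<in>{0<..<1}. p i (net_diff u v \<epsilon>)"
  note val = valuation_colombeau_diff[of I p, OF p i U V]
  have "ereal (real n) < net_valuation ?x"
    using less val
    by (cases "net_valuation ?x") (auto simp: sharp_dist_def e_abs_def)
  then obtain b where b: "real n < b" "(\<lambda>\<epsilon>. \<bar>?x \<epsilon>\<bar>) \<in> O[at_right 0](\<lambda>\<epsilon>. \<epsilon> powr b)"
    unfolding net_valuation_def less_Sup_iff by auto
  note b(2)
  also have "(\<lambda>\<epsilon>. \<epsilon> powr b) \<in> o[at_right 0](\<lambda>\<epsilon>. \<epsilon> powr real n)"
  proof (rule smalloI_tendsto)
    have "((\<lambda>\<epsilon>. \<epsilon> powr (b - real n)) \<longlongrightarrow> 0) (at_right 0)"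
      by (rule tendsto_zero_powrI[OF tendsto_ident_at tendsto_const])
         (use b(1) in \<open>auto intro: eventually_at_rightI[of 0 1]\<close>)
    moreover have "\<forall>\<^sub>F \<epsilon> in at_right 0. \<epsilon> powr (b - real n) = \<epsilon> powr b / \<epsilon> powr real n"
      by (intro always_eventually allI powr_diff)
    ultimately show "((\<lambda>\<epsilon>. \<epsilon> powr b / \<epsilon> powr real n) \<longlongrightarrow> 0) (at_right 0)"
      by (rule Lim_transform_eventually)
    show "\<forall>\<^sub>F \<epsilon> in at_right 0. \<epsilon> powr real n \<noteq> (0::real)"
      by (rule eventually_at_rightI[of 0 1]) auto
  qed
  finally have "\<forall>\<^sub>F \<epsilon> in at_right 0. norm \<bar>?x \<epsilon>\<bar> \<le> 1 * norm (\<epsilon> powr real n)"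
    by (rule landau_o.smallD) simp
  moreover note eventually_at_right_0_in_unit_interval
  ultimately show ?thesis
  proof eventually_elim
    case (elim \<epsilon>)
    then show ?case by (simp add: net_diff_def powr_realpow)
  qed
qed

lemma topspace_sharp_topology: "topspace (sharp_topology I p) = colombeau I p"
  by (auto simp: sharp_topology_def)

lemma openin_finite_sharp_ball:
  assumes F: "finite F" "F \<subseteq> I" and U: "U \<in> colombeau I p" and r: "0 < r"
  shows "openin (sharp_topology I p) {V \<in> colombeau I p. \<forall>i\<in>F. sharp_dist I p i V U < r}"
  using F
proof (induction F)
  case empty
  show ?case using openin_topspace[of "sharp_topology I p"] by (simp add: topspace_sharp_topology)
next
  case (insert i F)
  have "openin (sharp_topology I p) {V \<in> colombeau I p. sharp_dist I p i V U < r}"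
    unfolding sharp_topology_def sharp_dist_def
    by (rule topology_generated_by_Basis) (use insert.prems U r in blast)
  then have "openin (sharp_topology I p) ({V \<in> colombeau I p. sharp_dist I p i V U < r} \<inter>
      {V \<in> colombeau I p. \<forall>j\<in>F. sharp_dist I p j V U < r})"
    using insert by (intro openin_Int) auto
  also have "{V \<in> colombeau I p. sharp_dist I p i V U < r} \<inter>
      {V \<in> colombeau I p. \<forall>j\<in>F. sharp_dist I p j V U < r} =
      {V \<in> colombeau I p. \<forall>j\<in>insert i F. sharp_dist I p j V U < r}" by auto
  finally show ?case .
qed

section \<open>Sharp limits of internal sets\<close>

text \<open>Negligible nets are moderate, by the exponent \<open>m = 0\<close>, so \<open>v\<close> is moderate as the sum of \<open>u\<close>
  and a negligible net.\<close>

lemma negligible_perturbation_in_class: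
  assumes p: "\<And>i. i \<in> I \<Longrightarrow> seminorm (p i)"
    and U: "U \<in> colombeau I p" "u \<in> U" and v: "v \<in> nets"
    and small: "\<And>i m. i \<in> I \<Longrightarrow> \<forall>\<^sub>F \<epsilon> in at_right 0. p i (v \<epsilon> - u \<epsilon>) \<le> \<epsilon> ^ m"
  shows "v \<in> U"
proof -
  note u = colombeau_representative[of I p, OF p U]
  have neg: "net_diff v u \<in> negligible_nets I p"
    unfolding negligible_nets_def
  proof (intro CollectI conjI ballI allI net_diff_in_nets)
    fix i m assume i: "i \<in> I"
    note eventually_at_right_0_in_unit_interval
    with small[OF i, of m] have "\<forall>\<^sub>F \<epsilon> in at_right 0. p i (net_diff v u \<epsilon>) \<le> \<epsilon> ^ m"
      by eventually_elim (simp add: net_diff_def)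
    then show "\<exists>\<eta>\<in>{0<..<1}. \<forall>\<epsilon>\<in>{0<..\<eta>}. p i (net_diff v u \<epsilon>) \<le> \<epsilon> ^ m"
      by (simp add: eventually_at_right_0_iff)
  qed
  have mod: "net_diff v u \<in> moderate_nets I p"
    unfolding moderate_nets_def
  proof (intro CollectI conjI ballI net_diff_in_nets)
    fix i assume "i \<in> I"
    then obtain \<eta> where "\<eta> \<in> {0<..<1}" "\<forall>\<epsilon>\<in>{0<..\<eta>}. p i (net_diff v u \<epsilon>) \<le> \<epsilon> ^ 0"
      using neg unfolding negligible_nets_def by blast
    then show "\<exists>M::nat. \<exists>\<eta>\<in>{0<..<1}. \<forall>\<epsilon>\<in>{0<..\<eta>}. p i (net_diff v u \<epsilon>) \<le> \<epsilon> powr (- real M)"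
      by (intro exI[of _ 0] bexI[of _ \<eta>]) auto
  qed
  have "v \<in> moderate_nets I p"
  proof (rule moderate_add[OF p mod u(1) v])
    fix i \<epsilon> assume i: "i \<in> I" and e: "\<epsilon> \<in> {0<..<1::real}"
    show "p i (v \<epsilon>) \<le> p i (net_diff v u \<epsilon>) + p i (u \<epsilon>)"
      using e seminorm_add[OF p[OF i], of "v \<epsilon> - u \<epsilon>" "u \<epsilon>"] by (simp add: net_diff_def)
  qed auto
  then have "(v, u) \<in> colombeau_rel I p" using u neg by (simp add: colombeau_rel_def)
  then have "(u, v) \<in> colombeau_rel I p"
    using equiv_colombeau_rel[of I p, OF p] by (meson equivE symD)
  then show ?thesis using u(2) by (simp add: colombeau_class_def)
qed

text \<open>The diagonal argument. The conclusion \<open>v \<in> U\<close> needs every \<open>p i\<close>, although the net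
  \<open>w (N \<epsilon>)\<close> is controlled only by the seminorms in \<open>G (N \<epsilon>)\<close>: as \<open>N \<epsilon> \<rightarrow> \<infinity>\<close>, these eventually
  include the finite set \<open>F\<close> whose sum bounds \<open>p i\<close>.\<close>

lemma internal_set_sharp_limit:
  assumes p: "\<And>i. i \<in> I \<Longrightarrow> seminorm (p i)"
    and dom: "\<And>i. i \<in> I \<Longrightarrow> \<exists>F C. finite F \<and> (\<forall>\<^sub>F n in sequentially. F \<subseteq> G n) \<and>
           (\<forall>y. p i y \<le> C * (\<Sum>j\<in>F. p j y))"
    and G: "\<And>n. finite (G n)" "\<And>n. G n \<subseteq> I"
    and U: "U \<in> colombeau I p"
    and W: "\<And>n. W n \<in> internal_set I p A"
    and WU: "\<And>n i. i \<in> G n \<Longrightarrow> sharp_dist I p i (W n) U < exp (- real n)"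
  shows "U \<in> internal_set I p A"
proof -
  obtain u where u: "u \<in> U" using colombeau_nonempty[of I p, OF p U] by blast
  have "\<exists>w\<in>W n. \<exists>\<eta>>0. \<forall>\<epsilon>\<in>{0<..<1}. \<epsilon> < \<eta> \<longrightarrow> w \<epsilon> \<in> A \<epsilon>" for n
    using W[of n] by (simp add: internal_set_def)
  then obtain w \<eta> where w: "\<And>n. w n \<in> W n" and \<eta>: "\<And>n. 0 < \<eta> n"
    and wA: "\<And>n \<epsilon>. \<epsilon> \<in> {0<..<1} \<Longrightarrow> \<epsilon> < \<eta> n \<Longrightarrow> w n \<epsilon> \<in> A \<epsilon>" by metis
  have Wc: "W n \<in> colombeau I p" for n using W[of n] by (simp add: internal_set_def)
  define Q where "Q n \<epsilon> \<longleftrightarrow> w n \<epsilon> \<in> A \<epsilon> \<and> (\<forall>i\<in>G n. p i (w n \<epsilon> - u \<epsilon>) \<le> \<epsilon> ^ n)" for n \<epsilon>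
  have "eventually (Q n) (at_right 0)" for n
  proof -
    have "\<forall>\<^sub>F \<epsilon> in at_right 0. w n \<epsilon> \<in> A \<epsilon>"
      by (rule eventually_at_rightI[of 0 "min 1 (\<eta> n)"]) (use \<eta> wA in auto)
    moreover have "\<forall>\<^sub>F \<epsilon> in at_right 0. \<forall>i\<in>G n. p i (w n \<epsilon> - u \<epsilon>) \<le> \<epsilon> ^ n"
    proof (intro eventually_ball_finite G ballI)
      fix i assume i: "i \<in> G n"
      with G(2) have "i \<in> I" by blast
      from sharp_dist_less_imp_eventually_le[of I p, OF p this Wc w U u WU[OF i]]
      show "\<forall>\<^sub>F \<epsilon> in at_right 0. p i (w n \<epsilon> - u \<epsilon>) \<le> \<epsilon> ^ n" by blast
    qed
    ultimately show ?thesis by eventually_elim (simp add: Q_def)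
  qed
  then obtain N where N: "filterlim N sequentially (at_right 0)"
    and QN: "\<forall>\<^sub>F \<epsilon> in at_right 0. Q (N \<epsilon>) \<epsilon>" by (rule diagonal_choice_at_right_0)
  define v where "v = (\<lambda>\<epsilon>\<in>{0<..<1}. w (N \<epsilon>) \<epsilon>)"
  note ev01 = eventually_at_right_0_in_unit_interval
  have "v \<in> U"
  proof (rule negligible_perturbation_in_class[OF p U u])
    show "v \<in> nets" by (auto simp: v_def nets_def)
    fix i m assume "i \<in> I"
    then obtain F C where F: "finite F" "\<forall>\<^sub>F n in sequentially. F \<subseteq> G n"
      and le: "\<And>y. p i y \<le> C * (\<Sum>j\<in>F. p j y)" using dom by blast
    \<comment> \<open>A bound \<open>K * \<epsilon> ^ Suc m\<close> suffices: the additional factor \<open>\<epsilon>\<close> absorbs \<open>K\<close>.\<close>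
    define K where "K = \<bar>C\<bar> * real (card F)"
    have "((\<lambda>\<epsilon>. K * \<epsilon>) \<longlongrightarrow> K * 0) (at_right 0)" by (intro tendsto_intros)
    then have K: "\<forall>\<^sub>F \<epsilon> in at_right 0. K * \<epsilon> < 1" by (rule order_tendstoD) simp
    have FG: "\<forall>\<^sub>F \<epsilon> in at_right 0. F \<subseteq> G (N \<epsilon>)"
      using F(2) N by (rule eventually_compose_filterlim)
    have big: "\<forall>\<^sub>F \<epsilon> in at_right 0. Suc m \<le> N \<epsilon>"
      using N by (simp add: filterlim_at_top)
    show "\<forall>\<^sub>F \<epsilon> in at_right 0. p i (v \<epsilon> - u \<epsilon>) \<le> \<epsilon> ^ m"
      using QN ev01 K FG big
    proof eventually_elim
      case (elim \<epsilon>)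
      have e: "0 < \<epsilon>" "\<epsilon> < 1" using elim by auto
      have S: "(\<Sum>j\<in>F. p j (v \<epsilon> - u \<epsilon>)) \<le> real (card F) * \<epsilon> ^ N \<epsilon>"
        using elim by (intro sum_bounded_above) (auto simp: Q_def v_def)
      have S0: "0 \<le> (\<Sum>j\<in>F. p j (v \<epsilon> - u \<epsilon>))"
      proof (rule sum_nonneg)
        fix j assume "j \<in> F"
        then have "j \<in> I" using elim G(2) by blast
        then show "0 \<le> p j (v \<epsilon> - u \<epsilon>)" by (rule seminorm_ge0[OF p])
      qed
      have "p i (v \<epsilon> - u \<epsilon>) \<le> \<bar>C\<bar> * (\<Sum>j\<in>F. p j (v \<epsilon> - u \<epsilon>))"
        by (rule order_trans[OF le mult_right_mono[OF abs_ge_self S0]])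
      also have "\<dots> \<le> \<bar>C\<bar> * (real (card F) * \<epsilon> ^ N \<epsilon>)" using S by (intro mult_left_mono) auto
      also have "\<dots> = K * \<epsilon> ^ N \<epsilon>" by (simp add: K_def)
      also have "\<dots> \<le> K * \<epsilon> ^ Suc m"
        using e elim by (intro mult_left_mono power_decreasing) (auto simp: K_def)
      also have "\<dots> = (K * \<epsilon>) * \<epsilon> ^ m" by simp
      also have "\<dots> \<le> 1 * \<epsilon> ^ m" using e elim by (intro mult_right_mono) auto
      finally show ?case by simp
    qed
  qed
  moreover have "\<exists>\<eta>>0. \<forall>\<epsilon>\<in>{0<..<1}. \<epsilon> < \<eta> \<longrightarrow> v \<epsilon> \<in> A \<epsilon>"
  proof -
    have "\<forall>\<^sub>F \<epsilon> in at_right 0. v \<epsilon> \<in> A \<epsilon>"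
      using QN ev01 by eventually_elim (simp add: Q_def v_def)
    then show ?thesis by (auto simp: eventually_at_right_field)
  qed
  ultimately show ?thesis using U by (auto simp: internal_set_def)
qed

text \<open>If \<open>U\<close> lies outside the internal set, then some sharp ball \<open>B n\<close> of radius \<open>exp (- n)\<close> for the
  seminorms in \<open>G n\<close> misses the set; otherwise points chosen from all the balls would make \<open>U\<close>
  a limit, hence a member.\<close>

theorem theorem3p2:
  fixes I :: "'i set" and p :: "'i \<Rightarrow> 'a::real_vector \<Rightarrow> real"
    and \<A> :: "(real \<Rightarrow> 'a) set set"
  assumes "\<And>i. i \<in> I \<Longrightarrow> seminorm (p i)"
    and "countable_nhd_base_at (seminorm_topology I p) 0"
    and "internal I p \<A>"
  shows "closedin (sharp_topology I p) \<A>"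
proof -
  note p = assms(1)
  obtain A where A: "\<A> = internal_set I p A" using assms(3) by (auto simp: internal_def)
  obtain G where G: "\<And>n. finite (G n)" "\<And>n. G n \<subseteq> I"
    and dom: "\<And>i. i \<in> I \<Longrightarrow> \<exists>F C. finite F \<and> (\<forall>\<^sub>F n in sequentially. F \<subseteq> G n) \<and>
           (\<forall>y. p i y \<le> C * (\<Sum>j\<in>F. p j y))"
    using countable_exhaustion_of_seminorms[of I p, OF p assms(2)] by metis
  have "openin (sharp_topology I p) (colombeau I p - \<A>)"
  proof (subst openin_subopen, intro ballI)
    fix U assume U: "U \<in> colombeau I p - \<A>"
    define B where "B n = {V \<in> colombeau I p. \<forall>i\<in>G n. sharp_dist I p i V U < exp (- real n)}" for n
    have "\<exists>n. B n \<inter> \<A> = {}"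
    proof (rule ccontr)
      assume "\<nexists>n. B n \<inter> \<A> = {}"
      then have "\<forall>n. \<exists>V. V \<in> B n \<inter> \<A>" by blast
      then obtain W where "\<And>n. W n \<in> B n \<inter> \<A>" by metis
      then have "U \<in> internal_set I p A"
        using U A by (intro internal_set_sharp_limit[OF p dom G, of U W]) (auto simp: B_def)
      with U A show False by simp
    qed
    then obtain n where n: "B n \<inter> \<A> = {}" ..
    have "openin (sharp_topology I p) (B n)"
      unfolding B_def using G U by (intro openin_finite_sharp_ball) auto
    moreover have "U \<in> B n"
      using U subsetD[OF G(2)] sharp_dist_self[of I p, OF p] by (auto simp: B_def)
    moreover have "B n \<subseteq> colombeau I p - \<A>" using n by (auto simp: B_def)
    ultimately show "\<exists>T. openin (sharp_topology I p) T \<and> U \<in> T \<and> T \<subseteq> colombeau I p - \<A>" by blast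
  qed
  moreover have "\<A> \<subseteq> colombeau I p" by (auto simp: A internal_set_def)
  ultimately show ?thesis by (simp add: closedin_def topspace_sharp_topology)
qed

end
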